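(* Let $f\in\mathcal{C}[0,1]$ be arbitrary, let $b(x)=(f(1)-f(0))x+f(0)$, and let $\{T_k\}_{k\in\mathbb{N}}$ be the sequence of Read-Bajraktarević operators $$T_kg=f+\sum_{i=1}^{n_k}(S_{i,k}\circ l_{i,k}^{-1})\cdot\big((g-b)\circ l_{i,k}^{-1}\big)\,\chi_{l_{i,k}([0,1])}$$ acting on the complete metric space $(\mathcal{C}_*[0,1],d)$, as described in the context, where the functions $S_{i,k}\in\mathcal{C}[0,1]$ satisfy $s:=\sup_{k\in\mathbb{N}}\max_{1\le i\le n_k}\|S_{i,k}\|_\infty<1$. Let $$\mathscr{I}=\left\{g\in\mathcal{C}_*[0,1] : \|g\|_\infty\le\frac{\|f\|_\infty+s\,\|b\|_\infty}{1-s}\right\}.$$ Then there is a function $f^*\in\mathscr{I}$ such that, for any $f_0\in\mathscr{I}$, the backward trajectories $\Psi_k(f_0):=T_1\circ T_2\circ\cdots\circ T_k(f_0)$ converge to $f^*$ in $(\mathcal{C}_*[0,1],d)$ as $k\to\infty$. As $f_0$ one may choose $f$ or $b$ (i.e. $f,b\in\mathscr{I}$).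
   Context: Let $\mathcal{C}[0,1]$ be the space of continuous functions $[0,1]\to\mathbb{R}$ with supremum norm $\|\cdot\|_\infty$. For each $k\in\mathbb{N}$ let $n_k>1$ be an integer, let $0=x_{0,k}<x_{1,k}<\cdots<x_{n_k,k}=1$, and let $l_{1,k},\dots,l_{n_k,k}:[0,1]\to[0,1]$ be injective contractions (Lipschitz constant $<1$) with $l_{i,k}(0)=x_{i-1,k}$ and $l_{i,k}(1)=x_{i,k}$. Thus $l_{i,k}([0,1])=[x_{i-1,k},x_{i,k}]$, and these intervals cover $[0,1]$ and overlap only at endpoints. For the given $f\in\mathcal{C}[0,1]$, set $\mathcal{C}_*[0,1]:=\{g\in\mathcal{C}[0,1]: g(0)=f(0)\text{ and }g(1)=f(1)\}$, a complete metric space under the metric $d(g,h)=\|g-h\|_\infty$. Note $f,b\in\mathcal{C}_*[0,1]$. In the formula for $T_k$, $\chi_A$ is the characteristic function of $A$ and each summand is understood to be $0$ outside $l_{i,k}([0,1])$. At the nodes $x_{i,k}$ all summands vanish because $g-b$ vanishes at $0$ and $1$, so $T_kg$ is well defined and continuous, and $T_k$ maps $\mathcal{C}_*[0,1]$ into itself. *)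

theory Defs
  imports "HOL-Analysis.Analysis"
begin

text \<open>
  Elements of \<open>C[0,1]\<close> are continuous functions on \<open>{0..1}\<close> in the library's extensional encoding
  (value \<open>undefined\<close> outside \<open>{0..1}\<close>), so that the supremum distance separates points.
\<close>

definition C01 :: "(real \<Rightarrow> real) metric" where
  "C01 = cfunspace (top_of_set {0..1}) euclidean_metric"

definition sup_norm :: "(real \<Rightarrow> real) \<Rightarrow> real" where
  "sup_norm g = (SUP x\<in>{0..1}. \<bar>g x\<bar>)"

lemma mspace_C01: "mspace C01 = {g. g \<in> extensional {0..1} \<and> continuous_on {0..1} g}"
proof -
  have "Met_TC.mbounded (g ` {0..1})" if "continuous_on {0..1} g" for g :: "real \<Rightarrow> real"
  proof -
    have "bounded (g ` {0..1})"
      using that by (intro compact_imp_bounded compact_continuous_image) auto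
    then show ?thesis
      by (simp add: Met_TC.mbounded_def bounded_def mcball_eq_cball subset_iff dist_commute)
  qed
  then show ?thesis
    by (auto simp: C01_def)
qed

lemma mdist_C01:
  assumes "g \<in> mspace C01" "h \<in> mspace C01"
  shows "mdist C01 g h = sup_norm (\<lambda>x. g x - h x)"
  using assms
  by (simp add: C01_def cfunspace_def sup_norm_def Met_TC.fdist_def dist_real_def)

definition Cstar :: "(real \<Rightarrow> real) \<Rightarrow> (real \<Rightarrow> real) metric" where
  "Cstar f = submetric C01 {g. g 0 = f 0 \<and> g 1 = f 1}"

definition chord :: "(real \<Rightarrow> real) \<Rightarrow> real \<Rightarrow> real" where
  "chord f = (\<lambda>x\<in>{0..1}. (f 1 - f 0) * x + f 0)"

definition subdivision_maps :: "nat \<Rightarrow> (nat \<Rightarrow> real) \<Rightarrow> (nat \<Rightarrow> real \<Rightarrow> real) \<Rightarrow> bool" where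
  "subdivision_maps n x l \<longleftrightarrow>
     1 < n \<and> x 0 = 0 \<and> x n = 1 \<and> (\<forall>i<n. x i < x (Suc i)) \<and>
     (\<forall>i\<in>{1..n}. l i \<in> {0..1} \<rightarrow> {0..1} \<and> inj_on (l i) {0..1} \<and>
        (\<exists>c<1. c-lipschitz_on {0..1} (l i)) \<and> l i 0 = x (i - 1) \<and> l i 1 = x i)"

definition read_bajraktarevic ::
    "nat \<Rightarrow> (nat \<Rightarrow> real \<Rightarrow> real) \<Rightarrow> (nat \<Rightarrow> real \<Rightarrow> real) \<Rightarrow> (real \<Rightarrow> real) \<Rightarrow> (real \<Rightarrow> real) \<Rightarrow> (real \<Rightarrow> real)"
  where
  "read_bajraktarevic n l S f g =
     (\<lambda>x\<in>{0..1}. f x +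
        (\<Sum>i=1..n. if x \<in> l i ` {0..1}
           then let y = inv_into {0..1} (l i) x in S i y * (g y - chord f y)
           else 0))"

text \<open>The operators are indexed from 1: for \<open>k \<ge> 1\<close> this is \<open>T 1 \<circ> T 2 \<circ> \<dots> \<circ> T k\<close>.\<close>

primrec backward_trajectory :: "(nat \<Rightarrow> 'a \<Rightarrow> 'a) \<Rightarrow> nat \<Rightarrow> 'a \<Rightarrow> 'a" where
  "backward_trajectory T 0 = id"
| "backward_trajectory T (Suc k) = backward_trajectory T k \<circ> T (Suc k)"

definition invariant_ball :: "(real \<Rightarrow> real) \<Rightarrow> real \<Rightarrow> (real \<Rightarrow> real) set" where
  "invariant_ball f s =
     {g \<in> mspace (Cstar f). sup_norm g \<le> (sup_norm f + s * sup_norm (chord f)) / (1 - s)}"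

end

theory Submission
  imports Defs
begin

text \<open>
  Every \<open>T k\<close> maps the closed ball \<open>invariant_ball f s\<close> into itself and contracts distances by \<open>s\<close>,
  because at each point at most one summand is nonzero and it is bounded by \<open>s\<close> times the sup norm
  of the factor \<open>g - b\<close>. Since \<open>T 1 \<circ> \<dots> \<circ> T n = (T 1 \<circ> \<dots> \<circ> T m) \<circ> (T (m + 1) \<circ> \<dots> \<circ> T n)\<close>, the
  \<open>m\<close>-th and \<open>n\<close>-th terms of a backward trajectory both lie in \<open>T 1 \<circ> \<dots> \<circ> T m\<close> applied to the ball,
  a set of diameter at most \<open>s ^ m\<close> times that of the ball. So backward trajectories are Cauchy
  and their limits do not depend on the starting point.
\<close>

section \<open>Backward trajectories of uniform contractions on a bounded set\<close>

lemma backward_trajectory_in: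
  assumes "\<And>k x. k \<ge> 1 \<Longrightarrow> x \<in> A \<Longrightarrow> T k x \<in> A" and "x \<in> A"
  shows "backward_trajectory T k x \<in> A"
  using assms(2) by (induction k arbitrary: x) (auto simp: assms(1))

text \<open>The point \<open>z\<close> is the image of \<open>x\<close> under the inner maps
  \<open>T (m + 1)\<close>, ..., \<open>T (m + j)\<close>. The highest index acts first, so the
  induction peels it off at the starting point, which must therefore stay arbitrary.\<close>

lemma backward_trajectory_add:
  assumes T: "\<And>k x. k \<ge> 1 \<Longrightarrow> x \<in> A \<Longrightarrow> T k x \<in> A" and "x \<in> A"
  shows "\<exists>z\<in>A. backward_trajectory T (m + j) x = backward_trajectory T m z"
  using \<open>x \<in> A\<close>
proof (induction j arbitrary: x)
  case (Suc j)
  then show ?case using Suc.IH[OF T[of "Suc (m + j)" x]] by auto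
qed auto

context Metric_space
begin

lemma backward_trajectory_dist_le:
  assumes T: "\<And>k x. k \<ge> 1 \<Longrightarrow> x \<in> A \<Longrightarrow> T k x \<in> A"
    and contr: "\<And>k x y. k \<ge> 1 \<Longrightarrow> x \<in> A \<Longrightarrow> y \<in> A \<Longrightarrow> d (T k x) (T k y) \<le> s * d x y"
    and "0 \<le> s" "x \<in> A" "y \<in> A"
  shows "d (backward_trajectory T k x) (backward_trajectory T k y) \<le> s ^ k * d x y"
  using \<open>x \<in> A\<close> \<open>y \<in> A\<close>
proof (induction k arbitrary: x y)
  case (Suc k)
  have "d (backward_trajectory T k (T (Suc k) x)) (backward_trajectory T k (T (Suc k) y))
      \<le> s ^ k * d (T (Suc k) x) (T (Suc k) y)"
    using Suc by (intro Suc.IH T) auto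
  also have "\<dots> \<le> s ^ k * (s * d x y)"
    using Suc.prems \<open>0 \<le> s\<close> by (intro mult_left_mono contr) auto
  finally show ?case by (simp add: mult_ac)
qed auto

lemma backward_trajectory_converges:
  assumes mcomplete
    and A: "closedin mtopology A" "A \<noteq> {}"
    and bdd: "\<And>x y. x \<in> A \<Longrightarrow> y \<in> A \<Longrightarrow> d x y \<le> D"
    and T: "\<And>k x. k \<ge> 1 \<Longrightarrow> x \<in> A \<Longrightarrow> T k x \<in> A"
    and contr: "\<And>k x y. k \<ge> 1 \<Longrightarrow> x \<in> A \<Longrightarrow> y \<in> A \<Longrightarrow> d (T k x) (T k y) \<le> s * d x y"
    and s: "0 \<le> s" "s < 1"
  shows "\<exists>a\<in>A. \<forall>x\<in>A. limitin mtopology (\<lambda>k. backward_trajectory T k x) a sequentially"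
proof -
  let ?P = "backward_trajectory T"
  have in_A: "?P k x \<in> A" if "x \<in> A" for k x
    using T that by (rule backward_trajectory_in)
  have AM: "A \<subseteq> M"
    using closedin_subset[OF A(1)] by simp
  have dist: "d (?P k x) (?P k y) \<le> s ^ k * D" if "x \<in> A" "y \<in> A" for k x y
    using backward_trajectory_dist_le[where T = T and k = k, OF T contr s(1) that]
      mult_left_mono[OF bdd[OF that], of "s ^ k"] s by simp
  have "(\<lambda>k. s ^ k * D) \<longlonglongrightarrow> 0 * D"
    using s by (intro tendsto_mult LIMSEQ_power_zero) auto
  then have small: "\<exists>N. \<forall>k\<ge>N. s ^ k * D < e" if "e > 0" for e
    using that order_tendstoD(2)[of "\<lambda>k. s ^ k * D" 0 sequentially e]
    by (simp add: eventually_sequentially)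
  obtain x0 where x0: "x0 \<in> A" using A by auto
  \<comment> \<open>The point \<open>z\<close> produced by the tail of the composition changes with
    \<open>n\<close>, and only \<open>z \<in> A\<close> is known of it. The diameter bound
    \<open>D\<close> makes the estimate uniform in \<open>n\<close>.\<close>
  have tail: "d (?P m x0) (?P n x0) \<le> s ^ m * D" if "m \<le> n" for m n
  proof -
    have "\<exists>z\<in>A. ?P (m + (n - m)) x0 = ?P m z"
      using T x0 by (rule backward_trajectory_add)
    with dist[OF x0] that show ?thesis by auto
  qed
  have "MCauchy (\<lambda>k. ?P k x0)"
    unfolding MCauchy_def
  proof (intro conjI strip)
    show "range (\<lambda>k. ?P k x0) \<subseteq> M"
      using in_A[OF x0] AM by auto
    fix e :: real assume "e > 0"
    then obtain N where N: "\<And>k. k \<ge> N \<Longrightarrow> s ^ k * D < e" using small by blast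
    have "d (?P m x0) (?P n x0) < e" if "N \<le> m" "N \<le> n" for m n
      using tail[of m n] tail[of n m] N[of m] N[of n] that commute
      by (metis le_less_trans nat_le_linear)
    then show "\<exists>N. \<forall>n n'. N \<le> n \<longrightarrow> N \<le> n' \<longrightarrow> d (?P n x0) (?P n' x0) < e"
      by blast
  qed
  then obtain a where a: "limitin mtopology (\<lambda>k. ?P k x0) a sequentially"
    using \<open>mcomplete\<close> unfolding mcomplete_def by blast
  have "a \<in> A"
    using limitin_closedin[OF a A(1)] in_A[OF x0] by simp
  \<comment> \<open>Replacing the base point \<open>x0\<close> by \<open>x\<close> moves the
    \<open>k\<close>-th term by at most \<open>s ^ k * D\<close>, which takes one half of
    \<open>e\<close>; the convergence from \<open>x0\<close> takes the other half.\<close>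
  moreover have "limitin mtopology (\<lambda>k. ?P k x) a sequentially" if x: "x \<in> A" for x
    unfolding limit_metric_sequentially
  proof (intro conjI strip)
    show "a \<in> M" using \<open>a \<in> A\<close> AM by auto
    fix e :: real assume "e > 0"
    obtain N1 where N1: "\<And>k. k \<ge> N1 \<Longrightarrow> s ^ k * D < e/2"
      using small[of "e/2"] \<open>e > 0\<close> by auto
    obtain N2 where N2: "\<And>k. k \<ge> N2 \<Longrightarrow> d (?P k x0) a < e/2"
      using a \<open>e > 0\<close> unfolding limit_metric_sequentially by (meson half_gt_zero)
    have mem: "?P k y \<in> M" if "y \<in> A" for k y
      using in_A[OF that] AM by auto
    have "d (?P k x) a < e" if "k \<ge> max N1 N2" for k
      using triangle[OF mem[OF x, of k] mem[OF x0, of k] \<open>a \<in> M\<close>] dist[OF x x0, of k]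
        N1[of k] N2[of k] that by simp
    then show "\<exists>N. \<forall>n\<ge>N. ?P n x \<in> M \<and> d (?P n x) a < e"
      using mem[OF x] by blast
  qed
  ultimately show ?thesis by blast
qed

end

section \<open>The supremum norm and the complete space \<open>C01\<close>\<close>

lemma bdd_above_abs_image_unit:
  fixes g :: "real \<Rightarrow> real"
  assumes "continuous_on {0..1} g"
  shows "bdd_above ((\<lambda>t. \<bar>g t\<bar>) ` {0..1})"
  by (intro bounded_imp_bdd_above compact_imp_bounded compact_continuous_image
      continuous_intros assms) auto

lemma abs_le_sup_norm:
  assumes "continuous_on {0..1} g" "t \<in> {0..1}"
  shows "\<bar>g t\<bar> \<le> sup_norm g"
  unfolding sup_norm_def using assms(2)
  by (intro cSUP_upper bdd_above_abs_image_unit assms(1))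

lemma sup_norm_le:
  assumes "\<And>t. t \<in> {0..1} \<Longrightarrow> \<bar>g t\<bar> \<le> M"
  shows "sup_norm g \<le> M"
  unfolding sup_norm_def using assms by (intro cSUP_least) auto

lemma sup_norm_nonneg: "continuous_on {0..1} g \<Longrightarrow> 0 \<le> sup_norm g"
  using abs_le_sup_norm[of g 0] by fastforce

lemma abs_diff_le_mdist_C01:
  assumes "g \<in> mspace C01" "h \<in> mspace C01" "t \<in> {0..1}"
  shows "\<bar>g t - h t\<bar> \<le> mdist C01 g h"
  unfolding mdist_C01[OF assms(1,2)]
  using assms by (intro abs_le_sup_norm) (auto simp: mspace_C01 intro: continuous_on_diff)

text \<open>Completeness is inherited from the real line. The unfoldings identify
  \<open>Self\<close>, for which the general result is stated, with
  \<open>euclidean_metric\<close>.\<close>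

lemma mcomplete_of_C01: "mcomplete_of C01"
  unfolding C01_def euclidean_metric_def
  by (rule Met_TC.mcomplete_cfunspace[unfolded Met_TC.Self_def]) (simp add: complete_UNIV)

text \<open>Each difference of values is dominated by the supremum distance. This lets conditions on
  single values pass to the limit.\<close>

lemma limitin_C01_pointwise:
  assumes lim: "limitin (mtopology_of C01) \<sigma> g sequentially"
    and \<sigma>: "\<And>k. \<sigma> k \<in> mspace C01" and t: "t \<in> {0..1}"
  shows "(\<lambda>k. \<sigma> k t) \<longlonglongrightarrow> g t"
proof -
  interpret Metric_space "mspace C01" "mdist C01" by (rule Metric_space_mspace_mdist)
  have g: "g \<in> mspace C01" and conv: "(\<lambda>k. mdist C01 (\<sigma> k) g) \<longlonglongrightarrow> 0"
    using lim unfolding mtopology_of_def limit_metric_sequentially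
    by (auto simp: LIMSEQ_iff) meson
  have "(\<lambda>k. \<sigma> k t - g t) \<longlonglongrightarrow> 0"
    using conv abs_diff_le_mdist_C01[OF \<sigma> g t]
    by (intro Lim_null_comparison[OF _ conv]) (auto simp: always_eventually)
  then show ?thesis by (simp add: LIM_zero_iff)
qed

section \<open>The invariant ball as a closed subset of \<open>C01\<close>\<close>

text \<open>A pointwise bound in place of the norm bound suits both limits and estimates of the
  operator. Membership is expressed in the ambient space \<open>C01\<close>, where the convergence
  argument takes place.\<close>

lemma mem_invariant_ball_iff:
  "g \<in> invariant_ball f s \<longleftrightarrow>
     g \<in> mspace C01 \<and> g 0 = f 0 \<and> g 1 = f 1 \<and>
     (\<forall>t\<in>{0..1}. \<bar>g t\<bar> \<le> (sup_norm f + s * sup_norm (chord f)) / (1 - s))"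
proof -
  have "sup_norm g \<le> R \<longleftrightarrow> (\<forall>t\<in>{0..1}. \<bar>g t\<bar> \<le> R)" if "g \<in> mspace C01" for R
    using abs_le_sup_norm[of g] sup_norm_le[of g R] that by (fastforce simp: mspace_C01)
  then show ?thesis
    unfolding invariant_ball_def Cstar_def by auto
qed

text \<open>Endpoint equalities and weak pointwise inequalities survive pointwise limits.\<close>

lemma closedin_invariant_ball: "closedin (mtopology_of C01) (invariant_ball f s)"
proof -
  interpret Metric_space "mspace C01" "mdist C01" by (rule Metric_space_mspace_mdist)
  show ?thesis
    unfolding mtopology_of_def metric_closedin_iff_sequentially_closed
  proof (intro conjI allI impI)
    show "invariant_ball f s \<subseteq> mspace C01"
      by (auto simp: mem_invariant_ball_iff)
    fix \<sigma> g
    assume "range \<sigma> \<subseteq> invariant_ball f s \<and> limitin mtopology \<sigma> g sequentially"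
    then have \<sigma>: "\<sigma> k \<in> invariant_ball f s" and lim: "limitin mtopology \<sigma> g sequentially" for k
      by auto
    have pw: "(\<lambda>k. \<sigma> k t) \<longlonglongrightarrow> g t" if "t \<in> {0..1}" for t
      using limitin_C01_pointwise[of \<sigma> g t] lim \<sigma> that
      by (simp add: mtopology_of_def mem_invariant_ball_iff)
    have "g 0 = f 0" "g 1 = f 1"
      using pw[of 0] pw[of 1] \<sigma> by (auto simp: mem_invariant_ball_iff LIMSEQ_const_iff)
    moreover have "\<bar>g t\<bar> \<le> (sup_norm f + s * sup_norm (chord f)) / (1 - s)" if "t \<in> {0..1}" for t
      using tendsto_rabs[OF pw[OF that]] \<sigma> that
      by (intro LIMSEQ_le_const2[of "\<lambda>k. \<bar>\<sigma> k t\<bar>"]) (auto simp: mem_invariant_ball_iff)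
    moreover have "g \<in> mspace C01"
      using lim by (simp add: limitin_mspace)
    ultimately show "g \<in> invariant_ball f s"
      by (simp add: mem_invariant_ball_iff)
  qed
qed

section \<open>The affine interpolant \<open>chord f\<close>\<close>

lemma chord_simps [simp]: "chord f 0 = f 0" "chord f 1 = f 1"
  by (auto simp: chord_def)

lemma chord_in_C01: "chord f \<in> mspace C01"
proof -
  have "continuous_on {0..1} (\<lambda>x. (f 1 - f 0) * x + f 0)"
    by (intro continuous_intros)
  then have "continuous_on {0..1} (chord f)"
    by (rule continuous_on_eq) (simp add: chord_def)
  then show ?thesis
    by (simp add: mspace_C01 chord_def)
qed

text \<open>Every value of the chord is a convex combination of \<open>f 0\<close> and
  \<open>f 1\<close>.\<close>

lemma sup_norm_chord_le:
  assumes "continuous_on {0..1} f"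
  shows "sup_norm (chord f) \<le> sup_norm f"
proof (rule sup_norm_le)
  fix t :: real assume t: "t \<in> {0..1}"
  have "chord f t = (1 - t) * f 0 + t * f 1"
    using t by (simp add: chord_def algebra_simps)
  also have "\<bar>\<dots>\<bar> \<le> (1 - t) * \<bar>f 0\<bar> + t * \<bar>f 1\<bar>"
    using t by (intro order.trans[OF abs_triangle_ineq]) (auto simp: abs_mult)
  also have "\<dots> \<le> (1 - t) * sup_norm f + t * sup_norm f"
    using t by (intro add_mono mult_left_mono abs_le_sup_norm assms) auto
  finally show "\<bar>chord f t\<bar> \<le> sup_norm f" by (simp add: algebra_simps)
qed

section \<open>A single summand of the operator\<close>

text \<open>The extension by zero reaches over the whole real line, so continuity can be proved
  there without treating the first and last subinterval separately.\<close>

definition transplant :: "(real \<Rightarrow> real) \<Rightarrow> (real \<Rightarrow> real) \<Rightarrow> real \<Rightarrow> real" where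
  "transplant l w t = (if t \<in> l ` {0..1} then w (inv_into {0..1} l t) else 0)"

lemma read_bajraktarevic_eq:
  "read_bajraktarevic n l S f g =
     (\<lambda>t\<in>{0..1}. f t + (\<Sum>i=1..n. transplant (l i) (\<lambda>y. S i y * (g y - chord f y)) t))"
  unfolding read_bajraktarevic_def transplant_def Let_def ..

lemma abs_transplant_le:
  assumes "\<And>y. y \<in> {0..1} \<Longrightarrow> \<bar>w y\<bar> \<le> M"
  shows "\<bar>transplant l w t\<bar> \<le> M"
proof -
  have "0 \<le> M" using assms[of 0] by fastforce
  then show ?thesis
    using assms inv_into_into[of t l "{0..1}"] by (auto simp: transplant_def)
qed

lemma transplant_diff:
  "transplant l v t - transplant l w t = transplant l (\<lambda>y. v y - w y) t"
  by (simp add: transplant_def)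

context
  fixes l :: "real \<Rightarrow> real"
  assumes cont: "continuous_on {0..1} l" and inj: "inj_on l {0..1}" and less: "l 0 < l 1"
begin

lemma image_unit_eq: "l ` {0..1} = {l 0..l 1}"
  using continuous_injective_image_segment_1[of 0 1 l] cont inj less
  by (simp add: closed_segment_eq_real_ivl)

text \<open>The zeros of \<open>w\<close> at 0 and 1 remove the endpoints of the image interval.
  Summands over adjacent subintervals are thus never nonzero at the same point.\<close>

lemma transplant_nonzeroD:
  assumes "transplant l w t \<noteq> 0" "w 0 = 0" "w 1 = 0"
  shows "l 0 < t \<and> t < l 1"
proof -
  have "inv_into {0..1} l (l 0) = 0" "inv_into {0..1} l (l 1) = 1"
    using inj by (auto intro: inv_into_f_f)
  then have "t \<in> l ` {0..1}" "t \<noteq> l 0" "t \<noteq> l 1"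
    using assms by (auto simp: transplant_def split: if_splits)
  then show ?thesis
    using image_unit_eq by auto
qed

text \<open>Gluing along closed sets: on the image interval the inverse of \<open>l\<close> is
  continuous by compactness, and on the closed complement of its interior the function is zero. The
  pieces meet only at \<open>l 0\<close> and \<open>l 1\<close>.\<close>

lemma continuous_on_transplant:
  assumes w: "continuous_on {0..1} w" "w 0 = 0" "w 1 = 0"
  shows "continuous_on UNIV (transplant l w)"
proof -
  have "continuous_on (l ` {0..1}) (inv_into {0..1} l)"
    using cont inj by (intro continuous_on_inv) auto
  then have 1: "continuous_on {l 0..l 1} (\<lambda>t. w (inv_into {0..1} l t))"
    unfolding image_unit_eq[symmetric]
    by (rule continuous_on_compose2[OF w(1)]) (auto intro: inv_into_into)
  have "continuous_on {l 0..l 1} (transplant l w)"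
    using 1 by (rule continuous_on_eq) (simp add: transplant_def image_unit_eq)
  moreover have "continuous_on ({..l 0} \<union> {l 1..}) (transplant l w)"
    using transplant_nonzeroD[of w] w(2,3)
    by (intro continuous_on_eq[OF continuous_on_const[of _ 0]]) force
  ultimately have "continuous_on ({l 0..l 1} \<union> ({..l 0} \<union> {l 1..})) (transplant l w)"
    by (intro continuous_on_closed_Un) (auto intro: continuous_on_subset)
  moreover have "{l 0..l 1} \<union> ({..l 0} \<union> {l 1..}) = UNIV" by auto
  ultimately show ?thesis by simp
qed

end

section \<open>The operator of one subdivision\<close>

context
  fixes n :: nat and x :: "nat \<Rightarrow> real" and l :: "nat \<Rightarrow> real \<Rightarrow> real"
  assumes sub: "subdivision_maps n x l"
begin

lemma node_mono:
  assumes "i \<le> j" "j \<le> n"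
  shows "x i \<le> x j"
  using assms
proof (induction j rule: dec_induct)
  case (step j)
  then have "x j < x (Suc j)"
    using sub unfolding subdivision_maps_def by simp
  with step show ?case by simp
qed simp

lemma map_facts:
  assumes "i \<in> {1..n}"
  shows "continuous_on {0..1} (l i)" "inj_on (l i) {0..1}" "l i 0 < l i 1"
    "l i 0 = x (i - 1)" "l i 1 = x i"
proof -
  have "i - 1 < n"
    using assms by auto
  then have "x (i - 1) < x (Suc (i - 1))"
    using sub unfolding subdivision_maps_def by blast
  moreover have "Suc (i - 1) = i"
    using assms by simp
  moreover have li: "inj_on (l i) {0..1} \<and> (\<exists>c<1. c-lipschitz_on {0..1} (l i)) \<and>
      l i 0 = x (i - 1) \<and> l i 1 = x i"
    using sub assms unfolding subdivision_maps_def by blast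
  ultimately show "inj_on (l i) {0..1}" "l i 0 < l i 1" "l i 0 = x (i - 1)" "l i 1 = x i"
    by simp_all
  show "continuous_on {0..1} (l i)"
    using li lipschitz_on_continuous_on by blast
qed

text \<open>At most one summand is nonzero at \<open>t\<close>, because a nonzero one puts
  \<open>t\<close> strictly between its two nodes. Hence the bound is \<open>M\<close>, independent
  of the number of pieces.\<close>

lemma abs_sum_transplant_le:
  assumes W: "\<And>i y. i \<in> {1..n} \<Longrightarrow> y \<in> {0..1} \<Longrightarrow> \<bar>W i y\<bar> \<le> M"
    and W01: "\<And>i. i \<in> {1..n} \<Longrightarrow> W i 0 = 0 \<and> W i 1 = 0"
  shows "\<bar>\<Sum>i=1..n. transplant (l i) (W i) t\<bar> \<le> M"
proof (cases "\<exists>j\<in>{1..n}. transplant (l j) (W j) t \<noteq> 0")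
  case True
  then obtain j where j: "j \<in> {1..n}" "transplant (l j) (W j) t \<noteq> 0" by blast
  have loc: "x (i - 1) < t \<and> t < x i"
    if "i \<in> {1..n}" "transplant (l i) (W i) t \<noteq> 0" for i
    using transplant_nonzeroD[OF map_facts(1-3)[OF that(1)] that(2)] W01[OF that(1)]
      map_facts(4,5)[OF that(1)] by auto
  have zero: "transplant (l i) (W i) t = 0" if "i \<in> {1..n} - {j}" for i
  proof (rule ccontr)
    assume "transplant (l i) (W i) t \<noteq> 0"
    then have *: "x (i - 1) < t" "t < x i" "x (j - 1) < t" "t < x j"
      using loc[of i] loc[OF j] that by auto
    have "i \<le> j - 1 \<or> j \<le> i - 1" using that by auto
    then have "x i \<le> x (j - 1) \<or> x j \<le> x (i - 1)"
      by (rule disj_mono[THEN mp, rotated 2]) (use that j in \<open>auto intro!: node_mono\<close>)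
    then show False using * by linarith
  qed
  have "(\<Sum>i=1..n. transplant (l i) (W i) t) = transplant (l j) (W j) t"
    using j zero by (subst sum.remove[of _ j]) (auto intro: sum.neutral)
  then show ?thesis
    using abs_transplant_le[of "W j" M] W j by simp
next
  case False
  \<comment> \<open>The empty case leaves the sum 0, so \<open>M\<close> must be nonnegative; the
    index 1 exists because \<open>1 < n\<close>.\<close>
  have "0 \<le> M"
    using W[of 1 0] sub by (force simp: subdivision_maps_def)
  with False show ?thesis by simp
qed

context
  fixes S :: "nat \<Rightarrow> real \<Rightarrow> real" and f :: "real \<Rightarrow> real" and s :: real
  assumes S: "\<And>i. i \<in> {1..n} \<Longrightarrow> continuous_on {0..1} (S i)"
    and S_le: "\<And>i y. i \<in> {1..n} \<Longrightarrow> y \<in> {0..1} \<Longrightarrow> \<bar>S i y\<bar> \<le> s"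
    and f: "f \<in> mspace C01"
begin

lemma multiplier_bound_nonneg: "0 \<le> s"
  using S_le[of 1 0] sub by (force simp: subdivision_maps_def)

text \<open>This estimate serves twice: with \<open>u\<close> equal to \<open>g - chord f\<close>
  for the invariance of the ball, and with \<open>u\<close> a difference of two elements of the ball
  for the contraction.\<close>

lemma abs_sum_transplant_mult_le:
  assumes u: "\<And>y. y \<in> {0..1} \<Longrightarrow> \<bar>u y\<bar> \<le> M" and "u 0 = 0" "u 1 = 0"
  shows "\<bar>\<Sum>i=1..n. transplant (l i) (\<lambda>y. S i y * u y) t\<bar> \<le> s * M"
proof (rule abs_sum_transplant_le)
  fix i y assume "i \<in> {1..n}" "y \<in> {0..1::real}"
  then show "\<bar>S i y * u y\<bar> \<le> s * M"
    unfolding abs_mult using multiplier_bound_nonneg by (intro mult_mono S_le u) auto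
qed (use assms in auto)

lemma read_bajraktarevic_in_invariant_ball:
  assumes "s < 1" and g: "g \<in> invariant_ball f s"
  shows "read_bajraktarevic n l S f g \<in> invariant_ball f s"
proof -
  define R where "R = (sup_norm f + s * sup_norm (chord f)) / (1 - s)"
  let ?u = "\<lambda>y. g y - chord f y"
  let ?\<Sigma> = "\<lambda>t. \<Sum>i=1..n. transplant (l i) (\<lambda>y. S i y * ?u y) t"
  have g': "continuous_on {0..1} g" "g 0 = f 0" "g 1 = f 1"
    and gR: "\<And>t. t \<in> {0..1} \<Longrightarrow> \<bar>g t\<bar> \<le> R"
    using g by (auto simp: mem_invariant_ball_iff mspace_C01 R_def)
  have f': "continuous_on {0..1} f" and chord': "continuous_on {0..1} (chord f)"
    using f chord_in_C01[of f] by (auto simp: mspace_C01)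
  have "continuous_on {0..1} ?\<Sigma>"
  proof (intro continuous_on_sum)
    fix i assume i: "i \<in> {1..n}"
    have "continuous_on {0..1} (\<lambda>y. S i y * ?u y)"
      by (intro continuous_on_mult continuous_on_diff S i g' chord')
    then have "continuous_on UNIV (transplant (l i) (\<lambda>y. S i y * ?u y))"
      using g' by (intro continuous_on_transplant[OF map_facts(1-3)[OF i]]) simp_all
    then show "continuous_on {0..1} (transplant (l i) (\<lambda>y. S i y * ?u y))"
      by (rule continuous_on_subset) auto
  qed
  then have "continuous_on {0..1} (\<lambda>t. f t + ?\<Sigma> t)"
    by (intro continuous_on_add f')
  then have "continuous_on {0..1} (read_bajraktarevic n l S f g)"
    by (rule continuous_on_eq) (simp add: read_bajraktarevic_eq)
  then have mem: "read_bajraktarevic n l S f g \<in> mspace C01"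
    by (simp add: mspace_C01 read_bajraktarevic_eq)
  have u_le: "\<bar>?u y\<bar> \<le> R + sup_norm (chord f)" if "y \<in> {0..1}" for y
    using gR[OF that] abs_le_sup_norm[OF chord' that] by linarith
  have \<Sigma>_le: "\<bar>?\<Sigma> t\<bar> \<le> s * (R + sup_norm (chord f))" for t
    by (rule abs_sum_transplant_mult_le[OF u_le]) (simp_all add: g')
  \<comment> \<open>This explains the radius of the ball: \<open>R\<close> is the fixed point of the
    map sending a bound on \<open>g\<close> to the resulting bound on its image.\<close>
  have R: "sup_norm f + s * (R + sup_norm (chord f)) = R"
    using \<open>s < 1\<close> unfolding R_def by (simp add: field_simps)
  have "\<bar>read_bajraktarevic n l S f g t\<bar> \<le> R" if "t \<in> {0..1}" for t
    using that abs_le_sup_norm[OF f' that] \<Sigma>_le[of t] R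
    unfolding read_bajraktarevic_eq by simp
  \<comment> \<open>The open subintervals lie strictly inside the unit interval, so no summand
    disturbs the endpoint values of \<open>f\<close>.\<close>
  moreover have "transplant (l i) (\<lambda>y. S i y * ?u y) t = 0"
    if "i \<in> {1..n}" "t = 0 \<or> t = 1" for i t
  proof (rule ccontr)
    assume "transplant (l i) (\<lambda>y. S i y * ?u y) t \<noteq> 0"
    then have "x (i - 1) < t" "t < x i"
      using transplant_nonzeroD[OF map_facts(1-3)[OF that(1)]] map_facts(4,5)[OF that(1)] g'
      by fastforce+
    moreover have "x 0 \<le> x (i - 1)" "x i \<le> x n"
      using that(1) by (auto intro!: node_mono)
    moreover have "x 0 = 0" "x n = 1"
      using sub by (auto simp: subdivision_maps_def)
    ultimately show False using that(2) by auto
  qed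
  then have "?\<Sigma> 0 = 0" "?\<Sigma> 1 = 0" by (auto intro!: sum.neutral)
  then have "read_bajraktarevic n l S f g 0 = f 0" "read_bajraktarevic n l S f g 1 = f 1"
    unfolding read_bajraktarevic_eq by auto
  ultimately show ?thesis
    using mem by (simp add: mem_invariant_ball_iff R_def)
qed

lemma read_bajraktarevic_contraction:
  assumes "s < 1" and g: "g \<in> invariant_ball f s" and h: "h \<in> invariant_ball f s"
  shows "mdist C01 (read_bajraktarevic n l S f g) (read_bajraktarevic n l S f h)
      \<le> s * mdist C01 g h"
proof -
  have C01: "g \<in> mspace C01" "h \<in> mspace C01" "read_bajraktarevic n l S f g \<in> mspace C01"
    "read_bajraktarevic n l S f h \<in> mspace C01"
    using g h read_bajraktarevic_in_invariant_ball[OF \<open>s < 1\<close>]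
    by (auto simp: mem_invariant_ball_iff)
  have "\<bar>read_bajraktarevic n l S f g t - read_bajraktarevic n l S f h t\<bar> \<le> s * mdist C01 g h"
    if t: "t \<in> {0..1}" for t
  proof -
    \<comment> \<open>Both \<open>f\<close> and \<open>chord f\<close> cancel in the difference, and
      \<open>g - h\<close> vanishes at 0 and 1 since the endpoint values are prescribed.\<close>
    have "read_bajraktarevic n l S f g t - read_bajraktarevic n l S f h t =
        (\<Sum>i=1..n. transplant (l i) (\<lambda>y. S i y * (g y - h y)) t)"
      using t unfolding read_bajraktarevic_eq
      by (simp add: sum_subtractf[symmetric] transplant_diff algebra_simps)
    also have "\<bar>\<dots>\<bar> \<le> s * mdist C01 g h"
      using g h by (intro abs_sum_transplant_mult_le abs_diff_le_mdist_C01)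
        (auto simp: mem_invariant_ball_iff)
    finally show ?thesis .
  qed
  then show ?thesis
    unfolding mdist_C01[OF C01(3,4)] by (rule sup_norm_le)
qed

end

end

section \<open>Admissible starting points and the convergence theorem\<close>

text \<open>After clearing the denominator, the left side \<open>(1 - s) * sup_norm f\<close> is at
  most \<open>sup_norm f\<close>, and the right side is at least that.\<close>

lemma function_in_invariant_ball:
  assumes f: "f \<in> mspace C01" and s: "0 \<le> s" "s < 1"
  shows "f \<in> invariant_ball f s"
proof -
  have "continuous_on {0..1} f" "continuous_on {0..1} (chord f)"
    using f chord_in_C01[of f] by (auto simp: mspace_C01)
  then have "0 \<le> s * sup_norm f" "0 \<le> s * sup_norm (chord f)"
    using s sup_norm_nonneg by auto
  then have "sup_norm f \<le> (sup_norm f + s * sup_norm (chord f)) / (1 - s)"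
    using s by (simp add: pos_le_divide_eq algebra_simps)
  then show ?thesis using f by (simp add: invariant_ball_def Cstar_def)
qed

lemma chord_in_invariant_ball:
  assumes f: "f \<in> mspace C01" and s: "0 \<le> s" "s < 1"
  shows "chord f \<in> invariant_ball f s"
proof -
  have "sup_norm (chord f) \<le> sup_norm f"
    using f by (intro sup_norm_chord_le) (simp add: mspace_C01)
  also have "\<dots> \<le> (sup_norm f + s * sup_norm (chord f)) / (1 - s)"
    using function_in_invariant_ball[OF assms] by (simp add: invariant_ball_def)
  finally show ?thesis using chord_in_C01[of f] by (simp add: invariant_ball_def Cstar_def)
qed

text \<open>The assumption \<open>S_bdd\<close> gives the supremum in \<open>s_def\<close> its
  meaning: the real \<open>SUP\<close> of an unbounded set is an unspecified number, from which no
  bound on the multipliers follows.\<close>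

theorem theorem6p1:
  fixes f :: "real \<Rightarrow> real"
    and n :: "nat \<Rightarrow> nat"
    and x :: "nat \<Rightarrow> nat \<Rightarrow> real"
    and l S :: "nat \<Rightarrow> nat \<Rightarrow> real \<Rightarrow> real"
    and s :: real
    and T :: "nat \<Rightarrow> (real \<Rightarrow> real) \<Rightarrow> (real \<Rightarrow> real)"
  assumes f: "f \<in> mspace C01"
    and maps: "\<And>k. k \<ge> 1 \<Longrightarrow> subdivision_maps (n k) (x k) (l k)"
    and S: "\<And>k i. k \<ge> 1 \<Longrightarrow> i \<in> {1..n k} \<Longrightarrow> S k i \<in> mspace C01"
    and S_bdd: "bdd_above ((\<lambda>k. Max ((\<lambda>i. sup_norm (S k i)) ` {1..n k})) ` {1..})"
    and s_def: "s = (SUP k\<in>{1..}. Max ((\<lambda>i. sup_norm (S k i)) ` {1..n k}))"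
    and s_less: "s < 1"
    and T_def: "\<And>k. k \<ge> 1 \<Longrightarrow> T k = read_bajraktarevic (n k) (l k) (S k) f"
  shows "(\<exists>fstar \<in> invariant_ball f s. \<forall>f0 \<in> invariant_ball f s.
            limitin (mtopology_of (Cstar f)) (\<lambda>k. backward_trajectory T k f0) fstar sequentially)
         \<and> f \<in> invariant_ball f s \<and> chord f \<in> invariant_ball f s"
proof -
  have S_le: "\<bar>S k i y\<bar> \<le> s" if "k \<ge> 1" "i \<in> {1..n k}" "y \<in> {0..1}" for k i y
  proof -
    have "\<bar>S k i y\<bar> \<le> sup_norm (S k i)"
      using S[OF that(1,2)] that(3) by (intro abs_le_sup_norm) (auto simp: mspace_C01)
    also have "\<dots> \<le> Max ((\<lambda>i. sup_norm (S k i)) ` {1..n k})"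
      using that(2) by (intro Max_ge) auto
    also have "\<dots> \<le> s"
      unfolding s_def using that(1) by (intro cSUP_upper S_bdd) auto
    finally show ?thesis .
  qed
  have S_cont: "continuous_on {0..1} (S k i)" if "k \<ge> 1" "i \<in> {1..n k}" for k i
    using S[OF that] by (simp add: mspace_C01)
  have s0: "0 \<le> s"
    by (rule multiplier_bound_nonneg[OF maps[of 1] S_cont[of 1] S_le[of 1] f]) simp_all
  let ?I = "invariant_ball f s"
  note f_mem = function_in_invariant_ball[OF f s0 s_less]
  interpret Metric_space "mspace C01" "mdist C01" by (rule Metric_space_mspace_mdist)
  have T_mem: "T k g \<in> ?I" if "k \<ge> 1" "g \<in> ?I" for k g
    unfolding T_def[OF that(1)] using that s_less
    by (intro read_bajraktarevic_in_invariant_ball[OF maps] S_cont S_le f) auto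
  have "\<exists>a\<in>?I. \<forall>f0\<in>?I. limitin mtopology (\<lambda>k. backward_trajectory T k f0) a sequentially"
  proof (rule backward_trajectory_converges)
    show mcomplete
      using mcomplete_of_C01 by (simp add: mcomplete_of_def)
    show "closedin mtopology ?I"
      using closedin_invariant_ball by (simp add: mtopology_of_def)
    show "?I \<noteq> {}" using f_mem by auto
    let ?R = "(sup_norm f + s * sup_norm (chord f)) / (1 - s)"
    fix g h assume gh: "g \<in> ?I" "h \<in> ?I"
    \<comment> \<open>The diameter bound \<open>D\<close> is instantiated with twice the
      radius.\<close>
    have "\<bar>g t - h t\<bar> \<le> ?R + ?R" if "t \<in> {0..1}" for t
      using gh that by (intro order.trans[OF abs_triangle_ineq4] add_mono)
        (simp_all add: mem_invariant_ball_iff)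
    then show "mdist C01 g h \<le> ?R + ?R"
      using gh by (subst mdist_C01) (auto simp: mem_invariant_ball_iff intro: sup_norm_le)
  next
    fix k :: nat and g h assume "k \<ge> 1" "g \<in> ?I" "h \<in> ?I"
    then show "mdist C01 (T k g) (T k h) \<le> s * mdist C01 g h"
      unfolding T_def[OF \<open>k \<ge> 1\<close>] using s_less
      by (intro read_bajraktarevic_contraction[OF maps] S_cont S_le f) auto
  qed (use T_mem s0 s_less in auto)
  then obtain a where a: "a \<in> ?I"
    and lim: "\<And>f0. f0 \<in> ?I \<Longrightarrow>
      limitin (mtopology_of C01) (\<lambda>k. backward_trajectory T k f0) a sequentially"
    unfolding mtopology_of_def by blast
  \<comment> \<open>The topology of \<open>Cstar f\<close> is the subspace topology, so convergence
    in \<open>C01\<close> transfers once the limit and all terms are known to lie in the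
    ball.\<close>
  have "limitin (mtopology_of (Cstar f)) (\<lambda>k. backward_trajectory T k f0) a sequentially"
    if "f0 \<in> ?I" for f0
    using lim[OF that] a backward_trajectory_in[where T = T, OF T_mem that]
    unfolding Cstar_def mtopology_of_submetric limitin_subtopology
    by (auto simp: mem_invariant_ball_iff)
  then show ?thesis
    using a f_mem chord_in_invariant_ball[OF f s0 s_less] by blast
qed

end
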